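(* Let $\varphi:\mathbb{R}\to\mathbb{R}$ be a Lipschitz function with $\varphi(0)=0$ that is continuously differentiable and asymptotically linear, i.e. there exist $k_1,k_2\in\mathbb{R}$ with $\lim_{q\to-\infty}|\varphi'(q)-k_1|=0$ and $\lim_{q\to\infty}|\varphi'(q)-k_2|=0$. Let $\eta_{\mathrm{ref}}>0$, and let $\{\mathcal R_i\}_{i\in\mathcal I}$, $\mathcal I=\{1,\dots,N\}$, be a partition of $\mathbb{R}$ into intervals obtained by a uniform division of the image of $\varphi'$, i.e. such that $\ell(\varphi'(\mathcal R_i))=\ell(\varphi'(\mathcal R_j))$ for all $i,j\in\mathcal I$. Let $$r_i=\tfrac12\Big(\sup_{q\in\operatorname{int}\mathcal R_i}\varphi'(q)+\inf_{q\in\operatorname{int}\mathcal R_i}\varphi'(q)\Big),\qquad i\in\mathcal I,$$ and let $\varphi_{\mathrm{PWA}}(q)=r_iq+s_i$ for $q\in\mathcal R_i$, where the $s_i\in\mathbb{R}$ are chosen so that $\varphi_{\mathrm{PWA}}$ is continuous (and $\varphi_{\mathrm{PWA}}(0)=0$). If $N$ is chosen such that $\ell(\varphi'(\mathcal R_i))\le2\eta_{\mathrm{ref}}$, then the approximation error $\epsilon=\varphi-\varphi_{\mathrm{PWA}}$ is Lipschitz on $\mathbb{R}$ with a Lipschitz constant $\eta\le\eta_{\mathrm{ref}}$.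
   Context: A partition of $\mathbb{R}$ into intervals means finitely many closed (possibly unbounded) intervals $\mathcal R_i$ with non-empty, pairwise disjoint interiors whose union is $\mathbb{R}$. $\ell(\cdot)$ denotes the length of an interval; $\varphi'(\mathcal R_i)$ is the image of $\mathcal R_i$ under $\varphi'$, an interval by continuity of $\varphi'$. $\operatorname{int}$ denotes interior. *)

theory Defs
  imports "HOL-Analysis.Analysis"
begin

definition asymptotically_linear :: "(real \<Rightarrow> real) \<Rightarrow> bool" where
  "asymptotically_linear \<phi> \<longleftrightarrow>
     (\<exists>k1 k2. ((\<lambda>q. \<bar>deriv \<phi> q - k1\<bar>) \<longlongrightarrow> 0) at_bot \<and>
              ((\<lambda>q. \<bar>deriv \<phi> q - k2\<bar>) \<longlongrightarrow> 0) at_top)"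

definition interval_partition :: "nat \<Rightarrow> (nat \<Rightarrow> real set) \<Rightarrow> bool" where
  "interval_partition N R \<longleftrightarrow>
     (\<forall>i\<in>{1..N}. is_interval (R i) \<and> closed (R i) \<and> interior (R i) \<noteq> {}) \<and>
     disjoint_family_on (\<lambda>i. interior (R i)) {1..N} \<and>
     (\<Union>i\<in>{1..N}. R i) = UNIV"

text \<open>Meaningful for nonempty bounded intervals. It is applied below to images of intervals
  under the derivative of a Lipschitz function; these are bounded even if the interval is not.\<close>

definition interval_length :: "real set \<Rightarrow> real" where
  "interval_length J = Sup J - Inf J"

definition mid_slope :: "(real \<Rightarrow> real) \<Rightarrow> real set \<Rightarrow> real" where
  "mid_slope \<phi> J =
     ((SUP q\<in>interior J. deriv \<phi> q) + (INF q\<in>interior J. deriv \<phi> q)) / 2"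

end

theory Submission
  imports Defs
begin

text \<open>On each cell the error has derivative \<open>\<phi>' - r\<^sub>i\<close>, which by the choice of the midpoint slope
  is at most half the length of \<open>\<phi>'(R\<^sub>i)\<close>, so the mean value theorem gives the Lipschitz bound on
  the cell. Finitely many closed cells cover the line, so the bounds glue.\<close>

text \<open>Difference quotients are bounded by \<open>L\<close>, and the bound survives the limit.
  This makes every image of \<open>deriv \<phi>\<close> bounded, so that the suprema and infima in
  \<open>mid_slope\<close> and \<open>interval_length\<close> are genuine.\<close>

lemma lipschitz_on_UNIV_abs_deriv_le:
  fixes f :: "real \<Rightarrow> real"
  assumes lip: "L-lipschitz_on UNIV f" and der: "(f has_real_derivative D) (at x)"
  shows "\<bar>D\<bar> \<le> L"
proof (rule tendsto_upperbound)
  show "((\<lambda>h. \<bar>(f (x + h) - f x) / h\<bar>) \<longlongrightarrow> \<bar>D\<bar>) (at 0)"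
    using der by (intro tendsto_rabs) (simp add: DERIV_def)
  have "\<bar>(f (x + h) - f x) / h\<bar> \<le> L" if "h \<noteq> 0" for h
    using lipschitz_onD[OF lip, of "x + h" x] that
    by (simp add: dist_real_def divide_le_eq)
  then show "\<forall>\<^sub>F h in at 0. \<bar>(f (x + h) - f x) / h\<bar> \<le> L"
    by (simp add: eventually_at_filter)
qed simp

text \<open>The midpoint between two bounds is at most half their gap away from anything between
  them. The midpoint is taken over \<open>interior J\<close> and the length over \<open>J\<close>,
  but shrinking the set can only narrow the gap.\<close>

lemma abs_deriv_diff_mid_slope_le:
  assumes bdd: "bounded (deriv f ` J)" and z: "z \<in> interior J"
  shows "\<bar>deriv f z - mid_slope f J\<bar> \<le> interval_length (deriv f ` J) / 2"
proof -
  let ?I = "deriv f ` interior J"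
  have sub: "?I \<subseteq> deriv f ` J"
    using interior_subset by blast
  have above: "bdd_above (deriv f ` J)" and below: "bdd_below (deriv f ` J)"
    using bdd bounded_imp_bdd_above bounded_imp_bdd_below by auto
  \<comment> \<open>The point \<open>z\<close> makes \<open>?I\<close> nonempty, as monotonicity of
    \<open>Sup\<close> and \<open>Inf\<close> on the reals requires besides boundedness.\<close>
  have "Sup ?I \<le> Sup (deriv f ` J)" "Inf (deriv f ` J) \<le> Inf ?I"
    using z sub above below by (auto intro!: cSup_subset_mono cInf_superset_mono)
  moreover have "deriv f z \<le> Sup ?I" "Inf ?I \<le> deriv f z"
    using z bdd_above_mono[OF above sub] bdd_below_mono[OF below sub]
    by (auto intro!: cSup_upper cInf_lower)
  ultimately show ?thesis
    unfolding mid_slope_def interval_length_def by (simp add: abs_le_iff field_simps)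
qed

text \<open>The offset \<open>c\<close> vanishes on differentiation, so the mean value theorem gives
  the same constant whatever the offset of the cell, and also when \<open>J\<close> is
  unbounded.\<close>

lemma lipschitz_on_diff_mid_slope:
  assumes diff: "\<And>x. f differentiable (at x)"
    and J: "is_interval J" and bdd: "bounded (deriv f ` J)"
    and C: "interval_length (deriv f ` J) \<le> 2 * C" "0 \<le> C"
  shows "C-lipschitz_on J (\<lambda>q. f q - (mid_slope f J * q + c))"
proof (rule lipschitz_on_leI)
  fix x y assume xy: "x \<in> J" "y \<in> J" "x \<le> y"
  show "dist (f x - (mid_slope f J * x + c)) (f y - (mid_slope f J * y + c)) \<le> C * dist x y"
  proof (cases "x = y")
    case False
    let ?m = "mid_slope f J"
    define g where "g q = f q - (?m * q + c)" for q
    have "(g has_real_derivative deriv f z - ?m) (at z)" for z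
    proof -
      have "(f has_real_derivative deriv f z) (at z)"
        using diff by (simp add: DERIV_deriv_iff_real_differentiable)
      then show ?thesis
        unfolding g_def by (auto intro!: derivative_eq_intros)
    qed
    moreover have "x < y"
      using False xy by simp
    ultimately obtain z where z: "x < z" "z < y" and mvt: "g y - g x = (y - x) * (deriv f z - ?m)"
      using MVT2[of x y g "\<lambda>z. deriv f z - ?m"] by blast
    \<comment> \<open>\<open>mid_slope\<close> controls the derivative only on the interior. The
      mean value point lies there even if \<open>x\<close> or \<open>y\<close> is an endpoint of
      \<open>J\<close>.\<close>
    have "{x<..<y} \<subseteq> J"
      using mem_is_interval_1_I[OF J xy(1,2)] by auto
    then have "z \<in> interior J"
      using z by (meson greaterThanLessThan_iff interior_maximal open_greaterThanLessThan subsetD)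
    then have "\<bar>deriv f z - ?m\<bar> \<le> C"
      using abs_deriv_diff_mid_slope_le[OF bdd, of z] C(1) by simp
    then have "\<bar>(y - x) * (deriv f z - ?m)\<bar> \<le> C * (y - x)"
      using mult_right_mono[of "\<bar>deriv f z - ?m\<bar>" C "y - x"] xy by (simp add: abs_mult mult.commute)
    then show ?thesis
      unfolding mvt[symmetric] g_def using xy by (simp add: dist_real_def abs_minus_commute)
  qed simp
qed (use C in auto)

theorem proposition5p2:
  fixes \<phi> \<phi>PWA :: "real \<Rightarrow> real" and \<eta>ref :: real and N :: nat
    and R :: "nat \<Rightarrow> real set" and r s :: "nat \<Rightarrow> real"
  assumes "\<exists>L. L-lipschitz_on UNIV \<phi>"
    and "\<phi> 0 = 0"
    and "\<phi> C1_differentiable_on UNIV"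
    and "asymptotically_linear \<phi>"
    and "\<eta>ref > 0"
    and "interval_partition N R"
    and "\<forall>i\<in>{1..N}. \<forall>j\<in>{1..N}.
           interval_length (deriv \<phi> ` R i) = interval_length (deriv \<phi> ` R j)"
    and "\<forall>i\<in>{1..N}. r i = mid_slope \<phi> (R i)"
    and "\<forall>i\<in>{1..N}. \<forall>q\<in>R i. \<phi>PWA q = r i * q + s i"
    and "continuous_on UNIV \<phi>PWA"
    and "\<phi>PWA 0 = 0"
    and "\<forall>i\<in>{1..N}. interval_length (deriv \<phi> ` R i) \<le> 2 * \<eta>ref"
  shows "\<exists>\<eta>\<le>\<eta>ref. \<eta>-lipschitz_on UNIV (\<lambda>q. \<phi> q - \<phi>PWA q)"
proof (intro exI conjI lipschitz_onI)
  from assms(1) obtain L where L: "L-lipschitz_on UNIV \<phi>" by blast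
  have diff: "\<phi> differentiable (at x)" for x
    using assms(3) by (simp add: C1_differentiable_on_eq)
  then have "\<bar>deriv \<phi> x\<bar> \<le> L" for x
    using lipschitz_on_UNIV_abs_deriv_le[OF L, of "deriv \<phi> x" x]
    by (simp add: DERIV_deriv_iff_real_differentiable)
  \<comment> \<open>The bound \<open>L\<close> is global, so unbounded cells are covered as
    well.\<close>
  then have bdd: "bounded (deriv \<phi> ` J)" for J
    by (auto simp: bounded_iff)
  have part: "is_interval (R i)" "closed (R i)" if "i \<in> {1..N}" for i
    using assms(6) that by (auto simp: interval_partition_def)
  have cover: "(\<Union>i\<in>{1..N}. R i) = UNIV"
    using assms(6) by (simp add: interval_partition_def)
  have cell: "\<eta>ref-lipschitz_on (R i) (\<lambda>q. \<phi> q - \<phi>PWA q)" if i: "i \<in> {1..N}" for i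
  proof -
    have "\<eta>ref-lipschitz_on (R i) (\<lambda>q. \<phi> q - (mid_slope \<phi> (R i) * q + s i))"
      using lipschitz_on_diff_mid_slope[OF diff part(1)[OF i] bdd] assms(5,12) i by simp
    then show ?thesis
      by (rule lipschitz_on_transform) (use assms(8,9) i in auto)
  qed
  \<comment> \<open>Cutting a segment at cell boundaries keeps the constant, because the lengths of
    consecutive pieces add up on the line. The gluing rule works on \<open>{u..v}\<close>;
    \<open>min\<close> and \<open>max\<close> admit both orders of the two points.\<close>
  have lip: "\<eta>ref-lipschitz_on {min x y..max x y} (\<lambda>q. \<phi> q - \<phi>PWA q)" for x y
  proof (rule lipschitz_on_closed_Union)
    show "{min x y..max x y} \<subseteq> (\<Union>i\<in>{1..N}. R i)"
      unfolding cover by simp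
  qed (use cell part assms(5) in simp_all)
  \<comment> \<open>This fixes the constant left open by \<open>exI\<close> as
    \<open>\<eta>ref\<close> itself.\<close>
  show "dist (\<phi> x - \<phi>PWA x) (\<phi> y - \<phi>PWA y) \<le> \<eta>ref * dist x y" for x y
    by (rule lipschitz_onD[OF lip[of x y]]) auto
qed (use assms(5) in auto)

end
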